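(* Let $\lambda$ be a nonzero real number and $h$ a nonzero real number. Define the difference operator $\Delta_{x,h}f(x)=\frac{1}{h}\big(f(x+h)-f(x)\big)$, and let $\Delta_{x,h}^{n}$ denote its $n$-fold iterate ($\Delta_{x,h}^0$ the identity). Then for all integers $n,p\ge0$, $$ \frac{1}{n!}\Delta_{x,h}^{n}(x)_{p,\lambda}=\sum_{r=0}^{p}\binom{p}{r}(x)_{p-r,\lambda}\,h^{r-n}{r \brace n}_{\lambda/h}. $$
   Context: For a real parameter $\mu$ the degenerate falling factorials are $(x)_{0,\mu}=1$ and $(x)_{n,\mu}=x(x-\mu)\cdots(x-(n-1)\mu)$ for $n\ge1$; $(x)_n=(x)_{n,1}$ is the usual falling factorial. The degenerate Stirling numbers of the second kind ${n \brace k}_{\mu}$ are defined by $(x)_{n,\mu}=\sum_{k=0}^{n}{n \brace k}_{\mu}(x)_k$, with ${n \brace k}_{\mu}=0$ for $k>n$. *)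

theory Defs
  imports Complex_Main
begin

definition deg_ffact :: "real \<Rightarrow> real \<Rightarrow> nat \<Rightarrow> real" where
  "deg_ffact \<mu> x n = (\<Prod>i<n. x - real i * \<mu>)"

abbreviation ffact :: "real \<Rightarrow> nat \<Rightarrow> real" where
  "ffact x n \<equiv> deg_ffact 1 x n"

text \<open>The row \<open>c\<close> of coefficients in the expansion of the degenerate falling factorial of order
  \<open>n\<close> in ordinary falling factorials, extended by zero beyond \<open>n\<close>; the lemma
  \<open>ex1_deg_Stirling_row\<close> shows that it exists and is unique.\<close>

definition is_deg_Stirling_row :: "real \<Rightarrow> nat \<Rightarrow> (nat \<Rightarrow> real) \<Rightarrow> bool" where
  "is_deg_Stirling_row \<mu> n c \<longleftrightarrow>
     (\<forall>x. deg_ffact \<mu> x n = (\<Sum>k=0..n. c k * ffact x k)) \<and> (\<forall>k>n. c k = 0)"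

definition deg_Stirling2 :: "real \<Rightarrow> nat \<Rightarrow> nat \<Rightarrow> real" where
  "deg_Stirling2 \<mu> n = (THE c. is_deg_Stirling_row \<mu> n c)"

definition diff_op :: "real \<Rightarrow> (real \<Rightarrow> real) \<Rightarrow> real \<Rightarrow> real" where
  "diff_op h f = (\<lambda>x. (1 / h) * (f (x + h) - f x))"

lemma deg_ffact_0 [simp]: "deg_ffact \<mu> x 0 = 1"
  by (simp add: deg_ffact_def)

lemma deg_ffact_Suc: "deg_ffact \<mu> x (Suc n) = deg_ffact \<mu> x n * (x - real n * \<mu>)"
  by (simp add: deg_ffact_def)

lemma ffact_of_nat_eq_0: "m < k \<Longrightarrow> ffact (real m) k = 0"
  by (auto simp: deg_ffact_def)

lemma ffact_of_nat_self_neq_0: "ffact (real m) m \<noteq> 0"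
  by (auto simp: deg_ffact_def)

lemma ex_deg_Stirling_row: "\<exists>c. is_deg_Stirling_row \<mu> n c"
proof (induction n)
  case 0
  show ?case
    by (intro exI[of _ "\<lambda>k. if k = 0 then 1 else 0"]) (auto simp: is_deg_Stirling_row_def)
next
  case (Suc n)
  then obtain c where c: "\<And>x. deg_ffact \<mu> x n = (\<Sum>k=0..n. c k * ffact x k)"
    and c0: "\<And>k. k > n \<Longrightarrow> c k = 0"
    by (auto simp: is_deg_Stirling_row_def)
  define d where "d k = (if k = 0 then 0 else c (k - 1)) + (real k - real n * \<mu>) * c k" for k
  have "deg_ffact \<mu> x (Suc n) = (\<Sum>k=0..Suc n. d k * ffact x k)" for x
  proof -
    have "deg_ffact \<mu> x (Suc n) = (\<Sum>k=0..n. c k * ffact x k * (x - real n * \<mu>))"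
      by (simp add: deg_ffact_Suc c sum_distrib_right)
    also have "\<dots> = (\<Sum>k=0..n. c k * ffact x (Suc k) + (real k - real n * \<mu>) * c k * ffact x k)"
      by (rule sum.cong) (auto simp: deg_ffact_Suc algebra_simps)
    also have "\<dots> = (\<Sum>k=0..n. c k * ffact x (Suc k))
                    + (\<Sum>k=0..Suc n. (real k - real n * \<mu>) * c k * ffact x k)"
      by (simp add: sum.distrib c0)
    also have "(\<Sum>k=0..n. c k * ffact x (Suc k))
             = (\<Sum>k=0..Suc n. (if k = 0 then 0 else c (k - 1)) * ffact x k)"
      by (simp add: sum.atLeast0_atMost_Suc_shift del: sum.cl_ivl_Suc)
    finally show ?thesis
      by (simp add: d_def sum.distrib[symmetric] distrib_right del: sum.cl_ivl_Suc)
  qed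
  moreover have "\<forall>k>Suc n. d k = 0"
    by (auto simp: d_def c0)
  ultimately show ?case
    by (auto simp: is_deg_Stirling_row_def)
qed

lemma deg_Stirling_row_unique:
  assumes c: "is_deg_Stirling_row \<mu> n c" and d: "is_deg_Stirling_row \<mu> n d"
  shows "c = d"
proof
  fix m
  show "c m = d m"
  proof (induction m rule: less_induct)
    case (less m)
    show ?case
    proof (cases "m \<le> n")
      case False
      then show ?thesis using c d by (auto simp: is_deg_Stirling_row_def)
    next
      case True
      have "0 = (\<Sum>k=0..n. (c k - d k) * ffact (real m) k)"
        using c d by (simp add: is_deg_Stirling_row_def left_diff_distrib sum_subtractf)
      also have "\<dots> = (\<Sum>k\<in>{m}. (c k - d k) * ffact (real m) k)"
      proof (rule sum.mono_neutral_right)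
        show "\<forall>k\<in>{0..n} - {m}. (c k - d k) * ffact (real m) k = 0"
          using less ffact_of_nat_eq_0 by (metis Diff_iff diff_self insertI1 mult_eq_0_iff nat_neq_iff)
      qed (use True in auto)
      finally show ?thesis using ffact_of_nat_self_neq_0[of m] by simp
    qed
  qed
qed

lemma ex1_deg_Stirling_row: "\<exists>!c. is_deg_Stirling_row \<mu> n c"
  using ex_deg_Stirling_row deg_Stirling_row_unique by blast

lemma is_deg_Stirling_row_deg_Stirling2: "is_deg_Stirling_row \<mu> n (deg_Stirling2 \<mu> n)"
  unfolding deg_Stirling2_def by (rule theI'[OF ex1_deg_Stirling_row])

end

theory Submission
  imports Defs
begin

text \<open>By the Vandermonde convolution and rescaling, \<open>deg_ffact lam (x + h * t) p\<close>,
  as a function of \<open>t\<close>, is a combination of the ordinary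
  falling factorials of \<open>t\<close> whose \<open>n\<close>-th coefficient is \<open>h ^ n\<close> times the claimed
  right-hand side.
  Newton's forward difference formula identifies this coefficient with the \<open>n\<close>-th
  unit-step difference in \<open>t\<close> at \<open>0\<close>, divided by \<open>n!\<close>.\<close>

lemma deg_ffact_add:
  "deg_ffact \<mu> (x + y) p = (\<Sum>r\<le>p. real (p choose r) * deg_ffact \<mu> x (p - r) * deg_ffact \<mu> y r)"
proof (induction p)
  case 0
  show ?case by simp
next
  case (Suc p)
  let ?X = "deg_ffact \<mu> x" and ?Y = "deg_ffact \<mu> y"
  have "deg_ffact \<mu> (x + y) (Suc p)
      = (\<Sum>r\<le>p. real (p choose r) * ?X (p - r) * ?Y r * (x + y - real p * \<mu>))"
    by (simp add: deg_ffact_Suc Suc sum_distrib_right)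
  \<comment> \<open>Split the last factor as
    \<open>(x - real (p - r) * \<mu>) + (y - real r * \<mu>)\<close>: the parts extend
    \<open>?X\<close> and \<open>?Y\<close> respectively.\<close>
  also have "\<dots> = (\<Sum>r\<le>p. real (p choose r) * ?X (Suc p - r) * ?Y r
                        + real (p choose r) * ?X (p - r) * ?Y (Suc r))"
    by (rule sum.cong) (auto simp: deg_ffact_Suc Suc_diff_le of_nat_diff algebra_simps)
  also have "\<dots> = (\<Sum>r\<le>Suc p. real (p choose r) * ?X (Suc p - r) * ?Y r)
                + (\<Sum>r\<le>p. real (p choose r) * ?X (p - r) * ?Y (Suc r))"
    by (simp add: sum.distrib)
  \<comment> \<open>Pascal's rule, after shifting the index of the first sum.\<close>
  also have "\<dots> = (\<Sum>r\<le>Suc p. real (Suc p choose r) * ?X (Suc p - r) * ?Y r)"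
    by (simp add: sum.atMost_Suc_shift sum.distrib[symmetric] algebra_simps del: sum.atMost_Suc)
  finally show ?case .
qed

lemma deg_ffact_mult:
  assumes "h \<noteq> 0"
  shows "deg_ffact \<mu> (h * t) r = h ^ r * deg_ffact (\<mu> / h) t r"
  using assms by (induction r) (simp_all add: deg_ffact_Suc field_simps)

text \<open>Splitting off the leading factor, not the last one, lets both terms of the forward
  difference share \<open>ffact t k\<close>.\<close>

lemma ffact_add_1_Suc: "ffact (t + 1) (Suc k) = (t + 1) * ffact t k"
  by (induction k) (simp_all add: deg_ffact_Suc algebra_simps)

lemma ffact_forward_difference:
  "ffact (t + 1) (Suc k) - ffact t (Suc k) = real (Suc k) * ffact t k"
  unfolding ffact_add_1_Suc by (simp add: deg_ffact_Suc algebra_simps)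

text \<open>In \<open>t\<close>, with \<open>x\<close> fixed, \<open>diff_op h\<close> is the
  unit-step difference divided by \<open>h\<close>, so each application shifts the coefficients down
  by one; \<open>t = 0\<close> then isolates the constant one. Hence \<open>f\<close> and
  \<open>c\<close> vary in the induction.\<close>

lemma funpow_diff_op_newton:
  assumes "h \<noteq> 0"
    and "\<And>t. f (x + h * t) = (\<Sum>k\<le>m. c k * ffact t k)"
    and "\<And>k. k > m \<Longrightarrow> c k = 0"
  shows "(diff_op h ^^ n) f x = fact n * c n / h ^ n"
  using assms(2,3)
proof (induction n arbitrary: f c)
  case 0
  have "f x = (\<Sum>k\<le>m. c k * ffact 0 k)"
    using "0.prems"(1)[of 0] by simp
  also have "\<dots> = (\<Sum>k\<in>{0}. c k * ffact 0 k)"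
    using ffact_of_nat_eq_0[of 0] by (intro sum.mono_neutral_right) auto
  finally show ?case by simp
next
  case (Suc n)
  define d where "d k = real (Suc k) * c (Suc k) / h" for k
  have "diff_op h f (x + h * t) = (\<Sum>k\<le>m. d k * ffact t k)" for t
  proof -
    \<comment> \<open>The added term is zero; after the downward shift the range ends at
      \<open>m\<close> again, as the induction hypothesis needs.\<close>
    have extend: "f (x + h * s) = (\<Sum>k\<le>Suc m. c k * ffact s k)" for s
      using Suc.prems by simp
    have "diff_op h f (x + h * t) = (f (x + h * (t + 1)) - f (x + h * t)) / h"
      by (simp add: diff_op_def distrib_left add_ac)
    also have "\<dots> = (\<Sum>k\<le>m. c (Suc k) * (ffact (t + 1) (Suc k) - ffact t (Suc k))) / h"
      unfolding extend
      by (simp add: sum.atMost_Suc_shift sum_subtractf right_diff_distrib del: sum.atMost_Suc)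
    also have "\<dots> = (\<Sum>k\<le>m. d k * ffact t k)"
      unfolding ffact_forward_difference by (simp add: d_def sum_divide_distrib mult_ac)
    finally show ?thesis .
  qed
  moreover have "d k = 0" if "k > m" for k
    using that Suc.prems(2) by (simp add: d_def)
  ultimately have "(diff_op h ^^ n) (diff_op h f) x = fact n * d n / h ^ n"
    by (rule Suc.IH)
  then show ?case
    by (simp add: funpow_Suc_right d_def field_simps del: funpow.simps)
qed

lemma deg_Stirling2_eq_0: "r < k \<Longrightarrow> deg_Stirling2 \<mu> r k = 0"
  using is_deg_Stirling_row_deg_Stirling2[of \<mu> r] by (simp add: is_deg_Stirling_row_def)

text \<open>Padding with zeros to a bound \<open>m\<close> independent of \<open>r\<close> allows
  the later interchange of sums.\<close>

lemma deg_ffact_eq_sum_deg_Stirling2: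
  assumes "r \<le> m"
  shows "deg_ffact \<mu> t r = (\<Sum>k\<le>m. deg_Stirling2 \<mu> r k * ffact t k)"
proof -
  have "deg_ffact \<mu> t r = (\<Sum>k\<le>r. deg_Stirling2 \<mu> r k * ffact t k)"
    using is_deg_Stirling_row_deg_Stirling2[of \<mu> r]
    by (simp add: is_deg_Stirling_row_def atLeast0AtMost)
  also have "\<dots> = (\<Sum>k\<le>m. deg_Stirling2 \<mu> r k * ffact t k)"
    using assms by (intro sum.mono_neutral_left) (auto simp: deg_Stirling2_eq_0)
  finally show ?thesis .
qed

theorem theorem2p5:
  fixes lam h x :: real and n p :: nat
  assumes "lam \<noteq> 0" and "h \<noteq> 0"
  shows "1 / fact n * (diff_op h ^^ n) (\<lambda>y. deg_ffact lam y p) x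
       = (\<Sum>r=0..p. real (p choose r) * deg_ffact lam x (p - r)
            * h powi (int r - int n) * deg_Stirling2 (lam / h) r n)"
proof -
  \<comment> \<open>Rescaling \<open>h * t\<close> produces the factor \<open>h ^ r\<close> and
    turns \<open>lam\<close> into \<open>lam / h\<close>.\<close>
  define a where "a r = real (p choose r) * deg_ffact lam x (p - r) * h ^ r" for r
  define c where "c k = (\<Sum>r\<le>p. a r * deg_Stirling2 (lam / h) r k)" for k
  have "deg_ffact lam (x + h * t) p = (\<Sum>k\<le>p. c k * ffact t k)" for t
  proof -
    have "deg_ffact lam (x + h * t) p = (\<Sum>r\<le>p. a r * deg_ffact (lam / h) t r)"
      using assms(2) by (simp add: deg_ffact_add deg_ffact_mult a_def mult_ac)
    also have "\<dots> = (\<Sum>r\<le>p. \<Sum>k\<le>p. a r * deg_Stirling2 (lam / h) r k * ffact t k)"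
      by (intro sum.cong) (auto simp: deg_ffact_eq_sum_deg_Stirling2[of _ p] sum_distrib_left mult_ac)
    also have "\<dots> = (\<Sum>k\<le>p. c k * ffact t k)"
      by (subst sum.swap) (simp add: c_def sum_distrib_right)
    finally show ?thesis .
  qed
  moreover have "c k = 0" if "k > p" for k
    using that by (auto simp: c_def deg_Stirling2_eq_0)
  ultimately have "(diff_op h ^^ n) (\<lambda>y. deg_ffact lam y p) x = fact n * c n / h ^ n"
    by (rule funpow_diff_op_newton[OF assms(2)])
  then have "1 / fact n * (diff_op h ^^ n) (\<lambda>y. deg_ffact lam y p) x = c n / h ^ n"
    by simp
  \<comment> \<open>As \<open>h\<close> is nonzero, \<open>h powi (int r - int n)\<close> is
    \<open>h ^ r / h ^ n\<close>.\<close>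
  then show ?thesis
    using assms(2)
    by (simp add: c_def a_def power_int_diff sum_divide_distrib atLeast0AtMost mult_ac)
qed

end
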